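(* Let $S$ be a spherical surface of revolution with constant Gaussian curvature $K$ and metric $dr^2+f(r)^2d\theta^2$, let $\beta$ be a nonzero real number with $-ff''+(f')^2=\beta^2$ on $(r_N,r_S)$, and let $\Theta$ be the antiderivative of $1/f^2$ with $f'/f=-\beta^2\Theta$. Let $\gamma>0$ and consider the Hamiltonian system with Hamiltonian $$H=\frac{p_r^2}{2}+\frac{p_\theta^2}{2f(r)^2}+\gamma\,\Theta(r)$$ in the canonical coordinates $(r,\theta,p_r,p_\theta)\in(r_N,r_S)\times\mathbb{R}\times\mathbb{R}^2$. Then, besides $H$ and $p_\theta$, the functions $$I_1=\sin(\beta\theta)\,p_rp_\theta-\beta\cos(\beta\theta)\,\Theta(r)\,p_\theta^2-\frac{\gamma}{\beta}\cos(\beta\theta),$$ $$I_2=-\cos(\beta\theta)\,p_rp_\theta-\beta\sin(\beta\theta)\,\Theta(r)\,p_\theta^2-\frac{\gamma}{\beta}\sin(\beta\theta)$$ are constants of motion. The four constants of motion satisfy $$I_1^2+I_2^2=2p_\theta^2H-\frac{K p_\theta^4}{\beta^2}+\frac{\gamma^2}{\beta^2},$$ and three of the four functions $H,p_\theta,I_1,I_2$ are functionally independent; that is, the system is maximally superintegrable.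
   Context: Spherical surface of revolution: let $f,g$ be smooth functions on $[r_N,r_S]$ with $(f')^2+(g')^2=1$, $f\ge 0$, and $f(r)=0$ if and only if $r=r_N$ or $r=r_S$, such that $r\mapsto(f(r),0,g(r))$ is a simple curve. The surface $S$ is parametrized by $(r,\theta)\mapsto(f(r)\cos\theta,f(r)\sin\theta,g(r))$ and has (away from the poles $r=r_N,r_S$) the metric $dr^2+f(r)^2d\theta^2$, with Gaussian curvature $K=-f''/f$. A constant of motion is a function whose Poisson bracket with $H$ vanishes (equivalently, it is constant along solutions of Hamilton's equations $\dot r=\partial H/\partial p_r$, $\dot\theta=\partial H/\partial p_\theta$, $\dot p_r=-\partial H/\partial r$, $\dot p_\theta=-\partial H/\partial\theta$). The angle $\theta$ is treated as a real variable (locally on the surface). Functions are functionally independent if their differentials are linearly independent on an open dense subset of phase space. A system with 2 degrees of freedom is maximally superintegrable if it has $3$ functionally independent constants of motion. *)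

theory Defs
  imports "HOL-Analysis.Analysis"
begin

subsection \<open>Spherical surfaces of revolution\<close>

text \<open>Smoothness on a closed interval; derivatives at the end points are one-sided.\<close>

definition smooth_on_Icc :: "real \<Rightarrow> real \<Rightarrow> (real \<Rightarrow> real) \<Rightarrow> bool" where
  "smooth_on_Icc a b h \<longleftrightarrow>
     (\<exists>D :: nat \<Rightarrow> real \<Rightarrow> real. D 0 = h \<and>
        (\<forall>n. \<forall>r\<in>{a..b}. (D n has_real_derivative D (Suc n) r) (at r within {a..b})))"

definition spherical_surface_of_revolution ::
    "real \<Rightarrow> real \<Rightarrow> (real \<Rightarrow> real) \<Rightarrow> (real \<Rightarrow> real) \<Rightarrow> bool" where
  "spherical_surface_of_revolution rN rS f g \<longleftrightarrow>
     rN < rS \<and>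
     smooth_on_Icc rN rS f \<and> smooth_on_Icc rN rS g \<and>
     (\<forall>r\<in>{rN..rS}. (vector_derivative f (at r within {rN..rS}))\<^sup>2
                  + (vector_derivative g (at r within {rN..rS}))\<^sup>2 = 1) \<and>
     (\<forall>r\<in>{rN..rS}. f r \<ge> 0) \<and>
     (\<forall>r\<in>{rN..rS}. f r = 0 \<longleftrightarrow> r = rN \<or> r = rS) \<and>
     inj_on (\<lambda>r. (f r, 0 :: real, g r)) {rN..rS}"

text \<open>Gaussian curvature, away from the poles, of the metric \<open>dr\<^sup>2 + f(r)\<^sup>2 d\<theta>\<^sup>2\<close>.\<close>

definition gaussian_curvature :: "(real \<Rightarrow> real) \<Rightarrow> real \<Rightarrow> real" where
  "gaussian_curvature f r = - deriv (deriv f) r / f r"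


subsection \<open>Hamiltonian systems with two degrees of freedom\<close>

text \<open>A point of phase space is \<open>(r, \<theta>, p\<^sub>r, p\<^sub>\<theta>)\<close>.\<close>

type_synonym phase = "real \<times> real \<times> real \<times> real"

definition phase_space :: "real \<Rightarrow> real \<Rightarrow> phase set" where
  "phase_space rN rS = {rN<..<rS} \<times> UNIV \<times> UNIV \<times> UNIV"

abbreviation differential :: "(phase \<Rightarrow> real) \<Rightarrow> phase \<Rightarrow> phase \<Rightarrow> real" where
  "differential F z \<equiv> frechet_derivative F (at z)"

text \<open>\<open>k\<close> times continuously differentiable on \<open>U\<close>, which is meant to be open.\<close>

fun Ck_on :: "nat \<Rightarrow> phase set \<Rightarrow> (phase \<Rightarrow> real) \<Rightarrow> bool" where
  "Ck_on 0 U F \<longleftrightarrow> continuous_on U F"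
| "Ck_on (Suc k) U F \<longleftrightarrow>
     (\<forall>z\<in>U. F differentiable (at z)) \<and> (\<forall>v. Ck_on k U (\<lambda>z. differential F z v))"

definition smooth_on_phase :: "phase set \<Rightarrow> (phase \<Rightarrow> real) \<Rightarrow> bool" where
  "smooth_on_phase U F \<longleftrightarrow> (\<forall>k. Ck_on k U F)"

definition poisson_bracket :: "(phase \<Rightarrow> real) \<Rightarrow> (phase \<Rightarrow> real) \<Rightarrow> phase \<Rightarrow> real" where
  "poisson_bracket F G z =
     differential F z (1, 0, 0, 0) * differential G z (0, 0, 1, 0)
   - differential F z (0, 0, 1, 0) * differential G z (1, 0, 0, 0)
   + differential F z (0, 1, 0, 0) * differential G z (0, 0, 0, 1)
   - differential F z (0, 0, 0, 1) * differential G z (0, 1, 0, 0)"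

definition constant_of_motion :: "phase set \<Rightarrow> (phase \<Rightarrow> real) \<Rightarrow> (phase \<Rightarrow> real) \<Rightarrow> bool" where
  "constant_of_motion M H F \<longleftrightarrow>
     smooth_on_phase M F \<and> (\<forall>z\<in>M. poisson_bracket F H z = 0)"

text \<open>The family \<open>(F i)\<close>, \<open>i \<in> J\<close>, for a finite index set \<open>J\<close>; the set \<open>U\<close> is dense in \<open>M\<close>.\<close>

definition functionally_independent :: "phase set \<Rightarrow> 'i set \<Rightarrow> ('i \<Rightarrow> phase \<Rightarrow> real) \<Rightarrow> bool" where
  "functionally_independent M J F \<longleftrightarrow>
     (\<exists>U. open U \<and> U \<subseteq> M \<and> M \<subseteq> closure U \<and>
        (\<forall>z\<in>U. (\<forall>i\<in>J. F i differentiable (at z)) \<and>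
           (\<forall>c :: 'i \<Rightarrow> real. (\<forall>v. (\<Sum>i\<in>J. c i * differential (F i) z v) = 0)
                \<longrightarrow> (\<forall>i\<in>J. c i = 0))))"

text \<open>The number 3 is \<open>2n - 1\<close> for \<open>n = 2\<close> degrees of freedom.\<close>

definition maximally_superintegrable :: "phase set \<Rightarrow> (phase \<Rightarrow> real) \<Rightarrow> bool" where
  "maximally_superintegrable M H \<longleftrightarrow>
     (\<exists>F :: nat \<Rightarrow> phase \<Rightarrow> real.
        (\<forall>i<3. constant_of_motion M H (F i)) \<and> functionally_independent M {..<3} F)"


subsection \<open>The Hamiltonian and the integrals\<close>

definition Ham :: "(real \<Rightarrow> real) \<Rightarrow> (real \<Rightarrow> real) \<Rightarrow> real \<Rightarrow> phase \<Rightarrow> real" where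
  "Ham f \<Theta> \<gamma> = (\<lambda>(r, \<theta>, pr, p\<theta>). pr\<^sup>2 / 2 + p\<theta>\<^sup>2 / (2 * (f r)\<^sup>2) + \<gamma> * \<Theta> r)"

definition P\<theta> :: "phase \<Rightarrow> real" where
  "P\<theta> = (\<lambda>(r, \<theta>, pr, p\<theta>). p\<theta>)"

definition I1 :: "real \<Rightarrow> (real \<Rightarrow> real) \<Rightarrow> real \<Rightarrow> phase \<Rightarrow> real" where
  "I1 \<beta> \<Theta> \<gamma> = (\<lambda>(r, \<theta>, pr, p\<theta>).
     sin (\<beta> * \<theta>) * pr * p\<theta> - \<beta> * cos (\<beta> * \<theta>) * \<Theta> r * p\<theta>\<^sup>2 - \<gamma> / \<beta> * cos (\<beta> * \<theta>))"

definition I2 :: "real \<Rightarrow> (real \<Rightarrow> real) \<Rightarrow> real \<Rightarrow> phase \<Rightarrow> real" where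
  "I2 \<beta> \<Theta> \<gamma> = (\<lambda>(r, \<theta>, pr, p\<theta>).
     - cos (\<beta> * \<theta>) * pr * p\<theta> - \<beta> * sin (\<beta> * \<theta>) * \<Theta> r * p\<theta>\<^sup>2 - \<gamma> / \<beta> * sin (\<beta> * \<theta>))"

end

theory Submission
  imports Defs
begin

text \<open>Eliminating \<open>f''\<close> from \<open>f'' = - K f\<close> and \<open>- f f'' + f'\<^sup>2 = \<beta>\<^sup>2\<close> gives
  \<open>f'\<^sup>2 + K f\<^sup>2 = \<beta>\<^sup>2\<close>, and dividing by \<open>f\<^sup>2\<close> turns this into \<open>1 / f\<^sup>2 = \<beta>\<^sup>2 \<Theta>\<^sup>2 + K / \<beta>\<^sup>2\<close>.
  Hence \<open>\<Theta>\<close> solves the Riccati equation \<open>\<Theta>' = \<beta>\<^sup>2 \<Theta>\<^sup>2 + K / \<beta>\<^sup>2\<close>, and \<open>H, p\<^sub>\<theta>, I\<^sub>1, I\<^sub>2\<close> are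
  polynomials in \<open>\<Theta>(r), sin (\<beta>\<theta>), cos (\<beta>\<theta>), p\<^sub>r, p\<^sub>\<theta>\<close>, an algebra closed under differentiation.
  As \<open>H\<close> and \<open>p\<^sub>\<theta>\<close> do not depend on \<open>\<theta>\<close> and \<open>\<partial>I\<^sub>1/\<partial>\<theta> = - \<beta> I\<^sub>2\<close>, the differentials of
  \<open>H, p\<^sub>\<theta>, I\<^sub>1\<close> are independent wherever \<open>p\<^sub>r I\<^sub>2 \<noteq> 0\<close>.\<close>

section \<open>Openness of phase space and elementary rules for differentials\<close>

lemma open_phase_space: "open (phase_space a b)"
  unfolding phase_space_def by (intro open_Times open_greaterThanLessThan open_UNIV)

lemma differential_eq:
  assumes "(F has_derivative D) (at z)"
  shows "differential F z = D"
  using frechet_derivative_at[OF assms] by simp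

lemma has_derivative_compose_fst:
  fixes h :: "real \<Rightarrow> real"
  assumes "(h has_real_derivative t) (at (fst z))"
  shows "((\<lambda>z. h (fst z)) has_derivative (\<lambda>v. fst v * t)) (at z)"
  by (rule DERIV_compose_FDERIV[where f = h, OF assms has_derivative_fst[OF has_derivative_ident]])

subsection \<open>Smoothness of polynomial expressions\<close>

text \<open>On an open set, equal functions have equal derivatives, so the induction carries over.
  This allows a function such as \<open>H\<close> to be replaced by an expression that agrees with
  it on phase space only.\<close>

lemma Ck_on_cong:
  assumes "open U" "\<And>z. z \<in> U \<Longrightarrow> F z = G z" "Ck_on k U F"
  shows "Ck_on k U G"
  using assms(2,3)
proof (induction k arbitrary: F G)
  case 0
  then show ?case
    using continuous_on_cong[of U U F G] by simp
next
  case (Suc k)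
  have diff: "G differentiable (at z)" if "z \<in> U" for z
  proof -
    have "F differentiable (at z)"
      using Suc.prems(2) that by simp
    then obtain D where "(F has_derivative D) (at z)"
      unfolding differentiable_def by blast
    then show ?thesis
      using has_derivative_transform_within_open[of F D z UNIV U G] assms(1) that Suc.prems(1)
      unfolding differentiable_def by blast
  qed
  have "differential F z = differential G z" if "z \<in> U" for z
    using frechet_derivative_transform_within_open[of F z U G] Suc.prems that assms(1) by auto
  moreover have "Ck_on k U (\<lambda>z. differential F z v)" for v
    using Suc.prems(2)[unfolded Ck_on.simps] by (rule conjunct2[THEN spec])
  ultimately have "Ck_on k U (\<lambda>z. differential G z v)" for v
    using Suc.IH[of "\<lambda>z. differential F z v" "\<lambda>z. differential G z v"] by simp
  then show ?case
    using diff by simp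
qed

lemma smooth_on_phase_cong:
  assumes "open U" "\<And>z. z \<in> U \<Longrightarrow> F z = G z" "smooth_on_phase U F"
  shows "smooth_on_phase U G"
  using assms Ck_on_cong unfolding smooth_on_phase_def by blast

text \<open>A class of functions closed under directional derivatives, up to agreement on
  \<open>U\<close>, can be differentiated indefinitely without leaving it. The order
  \<open>k\<close> is the induction variable and \<open>F\<close> ranges over the class.\<close>

lemma smooth_on_phaseI:
  assumes "open U" "P F"
    and step: "\<And>F. P F \<Longrightarrow>
      \<exists>D. (\<forall>z\<in>U. (F has_derivative D z) (at z)) \<and> (\<forall>v. \<exists>G. P G \<and> (\<forall>z\<in>U. D z v = G z))"
  shows "smooth_on_phase U F"
proof -
  have "Ck_on k U F" if "P F" for k F
    using that
  proof (induction k arbitrary: F)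
    case 0
    then obtain D where "\<forall>z\<in>U. (F has_derivative D z) (at z)"
      using step by blast
    then show ?case
      by (auto intro!: continuous_at_imp_continuous_on has_derivative_continuous)
  next
    case (Suc k)
    obtain D where D: "\<forall>z\<in>U. (F has_derivative D z) (at z)"
      and G: "\<forall>v. \<exists>G. P G \<and> (\<forall>z\<in>U. D z v = G z)"
      using step[OF Suc.prems] by blast
    have "Ck_on k U (\<lambda>z. differential F z v)" for v
    proof -
      obtain G where "P G" "\<forall>z\<in>U. D z v = G z"
        using G by blast
      then have "G z = differential F z v" if "z \<in> U" for z
        using differential_eq[of F "D z" z] D that by simp
      then show ?thesis
        using Ck_on_cong[OF assms(1) _ Suc.IH[OF \<open>P G\<close>]] by simp
    qed
    then show ?case
      using D by (auto simp: differentiable_def)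
  qed
  then show ?thesis
    using assms(2) by (simp add: smooth_on_phase_def)
qed

text \<open>The real algebra of functions generated by \<open>A\<close>, made inductive so that
  closure under derivatives follows by rule induction.\<close>

inductive polynomial_in :: "(phase \<Rightarrow> real) set \<Rightarrow> (phase \<Rightarrow> real) \<Rightarrow> bool" for A where
  const: "polynomial_in A (\<lambda>_. c)"
| gen: "F \<in> A \<Longrightarrow> polynomial_in A F"
| add: "polynomial_in A F \<Longrightarrow> polynomial_in A G \<Longrightarrow> polynomial_in A (\<lambda>z. F z + G z)"
| mult: "polynomial_in A F \<Longrightarrow> polynomial_in A G \<Longrightarrow> polynomial_in A (\<lambda>z. F z * G z)"

lemma polynomial_in_minus:
  assumes "polynomial_in A F"
  shows "polynomial_in A (\<lambda>z. - F z)"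
  using polynomial_in.mult[OF polynomial_in.const[of A "-1"] assms] by simp

lemma polynomial_in_diff:
  assumes "polynomial_in A F" "polynomial_in A G"
  shows "polynomial_in A (\<lambda>z. F z - G z)"
  using polynomial_in.add[OF assms(1) polynomial_in_minus[OF assms(2)]] by simp

lemma polynomial_in_power:
  assumes "polynomial_in A F"
  shows "polynomial_in A (\<lambda>z. F z ^ n)"
  by (induction n) (auto intro: polynomial_in.intros assms)

lemmas polynomial_in_intros =
  polynomial_in.const polynomial_in.add polynomial_in.mult
  polynomial_in_minus polynomial_in_diff polynomial_in_power

text \<open>By the sum and product rules, closure of the algebra under derivatives has to be checked
  on the generators only.\<close>

lemma smooth_polynomial_in:
  assumes "open U" "polynomial_in A F"
    and gens: "\<And>F. F \<in> A \<Longrightarrow> \<exists>D. (\<forall>z\<in>U. (F has_derivative D z) (at z)) \<and>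
                 (\<forall>v. \<exists>G. polynomial_in A G \<and> (\<forall>z\<in>U. D z v = G z))"
  shows "smooth_on_phase U F"
proof (rule smooth_on_phaseI[of U "polynomial_in A", OF assms(1,2)])
  fix F assume "polynomial_in A F"
  then show "\<exists>D. (\<forall>z\<in>U. (F has_derivative D z) (at z)) \<and>
               (\<forall>v. \<exists>G. polynomial_in A G \<and> (\<forall>z\<in>U. D z v = G z))"
  proof induction
    case (const c)
    show ?case
      by (rule exI[of _ "\<lambda>_ _. 0"]) (auto intro: polynomial_in.const)
  next
    case (gen F)
    then show ?case by (rule gens)
  next
    case (add F1 F2)
    obtain D1 D2 where D: "\<forall>z\<in>U. (F1 has_derivative D1 z) (at z)"
        "\<forall>z\<in>U. (F2 has_derivative D2 z) (at z)"
      and G: "\<forall>v. \<exists>G. polynomial_in A G \<and> (\<forall>z\<in>U. D1 z v = G z)"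
        "\<forall>v. \<exists>G. polynomial_in A G \<and> (\<forall>z\<in>U. D2 z v = G z)"
      using add.IH by blast
    have "\<exists>G. polynomial_in A G \<and> (\<forall>z\<in>U. D1 z v + D2 z v = G z)" for v
    proof -
      obtain G1 G2 where "polynomial_in A G1" "polynomial_in A G2"
        "\<forall>z\<in>U. D1 z v = G1 z" "\<forall>z\<in>U. D2 z v = G2 z"
        using G by meson
      then show ?thesis
        by (intro exI[of _ "\<lambda>z. G1 z + G2 z"]) (auto intro: polynomial_in.add)
    qed
    then show ?case
      using D by (intro exI[of _ "\<lambda>z v. D1 z v + D2 z v"]) (auto intro: has_derivative_add)
  next
    case (mult F1 F2)
    obtain D1 D2 where D: "\<forall>z\<in>U. (F1 has_derivative D1 z) (at z)"
        "\<forall>z\<in>U. (F2 has_derivative D2 z) (at z)"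
      and G: "\<forall>v. \<exists>G. polynomial_in A G \<and> (\<forall>z\<in>U. D1 z v = G z)"
        "\<forall>v. \<exists>G. polynomial_in A G \<and> (\<forall>z\<in>U. D2 z v = G z)"
      using mult.IH by blast
    have "\<exists>G. polynomial_in A G \<and> (\<forall>z\<in>U. F1 z * D2 z v + D1 z v * F2 z = G z)" for v
    proof -
      obtain G1 G2 where "polynomial_in A G1" "polynomial_in A G2"
        "\<forall>z\<in>U. D1 z v = G1 z" "\<forall>z\<in>U. D2 z v = G2 z"
        using G by meson
      then show ?thesis
        using mult.hyps
        by (intro exI[of _ "\<lambda>z. F1 z * G2 z + G1 z * F2 z"]) (auto intro!: polynomial_in_intros)
    qed
    then show ?case
      using D by (intro exI[of _ "\<lambda>z v. F1 z * D2 z v + D1 z v * F2 z"])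
        (auto intro: has_derivative_mult)
  qed
qed

definition phase_gens :: "real \<Rightarrow> (real \<Rightarrow> real) \<Rightarrow> (phase \<Rightarrow> real) set" where
  "phase_gens \<beta> \<Theta> =
     {\<lambda>z. \<Theta> (fst z), \<lambda>z. sin (\<beta> * fst (snd z)), \<lambda>z. cos (\<beta> * fst (snd z)),
      \<lambda>z. fst (snd (snd z)), \<lambda>z. snd (snd (snd z))}"

lemma polynomial_in_phase_gens:
  "polynomial_in (phase_gens \<beta> \<Theta>) (\<lambda>z. \<Theta> (fst z))"
  "polynomial_in (phase_gens \<beta> \<Theta>) (\<lambda>z. sin (\<beta> * fst (snd z)))"
  "polynomial_in (phase_gens \<beta> \<Theta>) (\<lambda>z. cos (\<beta> * fst (snd z)))"
  "polynomial_in (phase_gens \<beta> \<Theta>) (\<lambda>z. fst (snd (snd z)))"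
  "polynomial_in (phase_gens \<beta> \<Theta>) (\<lambda>z. snd (snd (snd z)))"
  by (auto simp: phase_gens_def intro: polynomial_in.gen)

text \<open>The Riccati equation makes the derivative of \<Theta> a polynomial in \<Theta>; sine and
  cosine differentiate into each other, and the momenta into constants.\<close>

lemma smooth_polynomial_in_phase_gens:
  assumes riccati: "\<And>r. r \<in> {a<..<b} \<Longrightarrow> (\<Theta> has_real_derivative \<beta>\<^sup>2 * (\<Theta> r)\<^sup>2 + \<kappa>) (at r)"
    and "polynomial_in (phase_gens \<beta> \<Theta>) F"
  shows "smooth_on_phase (phase_space a b) F"
proof (rule smooth_polynomial_in[OF open_phase_space assms(2)])
  let ?U = "phase_space a b" and ?P = "polynomial_in (phase_gens \<beta> \<Theta>)"
  note poly = polynomial_in_intros polynomial_in_phase_gens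
  fix F assume "F \<in> phase_gens \<beta> \<Theta>"
  \<comment> \<open>Each generator depends on a single coordinate, so its differential is a
    functional \<open>l\<close> of the direction times a function \<open>G\<close> of the point; for
    fixed \<open>v\<close> the factor \<open>l v\<close> is a constant.\<close>
  have witness: "\<exists>D. (\<forall>z\<in>?U. (F has_derivative D z) (at z)) \<and>
                 (\<forall>v. \<exists>G. ?P G \<and> (\<forall>z\<in>?U. D z v = G z))"
    if "\<And>z. z \<in> ?U \<Longrightarrow> (F has_derivative (\<lambda>v. l v * G z)) (at z)" "?P G" for F l G
  proof (intro exI[of _ "\<lambda>z v. l v * G z"] conjI allI ballI)
    show "\<exists>G'. ?P G' \<and> (\<forall>z\<in>?U. l v * G z = G' z)" for v
      using that(2) by (intro exI[of _ "\<lambda>z. l v * G z"]) (auto intro!: polynomial_in_intros)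
  qed (rule that(1))
  have dT: "((\<lambda>z. \<Theta> (fst z)) has_derivative (\<lambda>v. fst v * (\<beta>\<^sup>2 * (\<Theta> (fst z))\<^sup>2 + \<kappa>))) (at z)"
    if "z \<in> ?U" for z
    using that
    by (intro has_derivative_compose_fst riccati)
      (auto simp: phase_space_def)
  have ds: "((\<lambda>z. sin (\<beta> * fst (snd z))) has_derivative
      (\<lambda>v. \<beta> * fst (snd v) * cos (\<beta> * fst (snd z)))) (at z)" for z :: phase
    by (auto intro!: derivative_eq_intros)
  have dc: "((\<lambda>z. cos (\<beta> * fst (snd z))) has_derivative
      (\<lambda>v. \<beta> * fst (snd v) * - sin (\<beta> * fst (snd z)))) (at z)" for z :: phase
    by (auto intro!: derivative_eq_intros)
  have dp: "((\<lambda>z. fst (snd (snd z))) has_derivative (\<lambda>v. fst (snd (snd v)) * 1)) (at z)"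
    "((\<lambda>z. snd (snd (snd z))) has_derivative (\<lambda>v. snd (snd (snd v)) * 1)) (at z)" for z :: phase
    by (auto intro!: derivative_eq_intros)
  from \<open>F \<in> phase_gens \<beta> \<Theta>\<close>
  consider "F = (\<lambda>z. \<Theta> (fst z))" | "F = (\<lambda>z. sin (\<beta> * fst (snd z)))"
    | "F = (\<lambda>z. cos (\<beta> * fst (snd z)))" | "F = (\<lambda>z. fst (snd (snd z)))"
    | "F = (\<lambda>z. snd (snd (snd z)))"
    unfolding phase_gens_def by blast
  then show "\<exists>D. (\<forall>z\<in>?U. (F has_derivative D z) (at z)) \<and>
                (\<forall>v. \<exists>G. ?P G \<and> (\<forall>z\<in>?U. D z v = G z))"
  proof cases
    case 1
    show ?thesis unfolding 1 by (rule witness, erule dT) (intro poly)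
  next
    case 2
    show ?thesis unfolding 2 by (rule witness, rule ds) (intro poly)
  next
    case 3
    show ?thesis unfolding 3 by (rule witness, rule dc) (intro poly)
  next
    case 4
    show ?thesis unfolding 4 by (rule witness, rule dp(1)) (intro poly)
  next
    case 5
    show ?thesis unfolding 5 by (rule witness, rule dp(2)) (intro poly)
  qed
qed

subsection \<open>The differentials of the four functions\<close>

lemma has_derivative_Ham:
  assumes "f r \<noteq> 0" "(f has_real_derivative f') (at r)" "(\<Theta> has_real_derivative t) (at r)"
  shows "(Ham f \<Theta> \<gamma> has_derivative
           (\<lambda>(a, b, c, d). (\<gamma> * t - p\<theta>\<^sup>2 * f' / (f r)^3) * a + pr * c + p\<theta> / (f r)\<^sup>2 * d))
         (at (r, \<theta>, pr, p\<theta>))"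
proof -
  have f: "((\<lambda>z. f (fst z)) has_derivative (\<lambda>z. fst z * f')) (at (r, \<theta>, pr, p\<theta>))"
    and T: "((\<lambda>z. \<Theta> (fst z)) has_derivative (\<lambda>z. fst z * t)) (at (r, \<theta>, pr, p\<theta>))"
    using assms by (auto intro: has_derivative_compose_fst)
  show ?thesis
    unfolding Ham_def case_prod_beta
    using assms(1)
    by (auto intro!: derivative_eq_intros f T ext
        simp: field_simps power2_eq_square power3_eq_cube)
qed

lemma has_derivative_P\<theta>: "(P\<theta> has_derivative (\<lambda>(a, b, c, d). d)) (at z)"
  unfolding P\<theta>_def case_prod_beta by (auto intro!: derivative_eq_intros)

text \<open>Up to the factor \<beta>, differentiating in \<theta> turns the vector
  (\<open>I1\<close>, \<open>I2\<close>) by a quarter turn, which is why the other integral appears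
  as a coefficient here and in the next lemma.\<close>

lemma has_derivative_I1:
  assumes "\<beta> \<noteq> 0" "(\<Theta> has_real_derivative t) (at r)"
  shows "(I1 \<beta> \<Theta> \<gamma> has_derivative
           (\<lambda>(a, b, c, d). - \<beta> * cos (\<beta> * \<theta>) * t * p\<theta>\<^sup>2 * a - \<beta> * I2 \<beta> \<Theta> \<gamma> (r, \<theta>, pr, p\<theta>) * b
              + sin (\<beta> * \<theta>) * p\<theta> * c
              + (sin (\<beta> * \<theta>) * pr - 2 * \<beta> * cos (\<beta> * \<theta>) * \<Theta> r * p\<theta>) * d))
         (at (r, \<theta>, pr, p\<theta>))"
proof -
  have T: "((\<lambda>z. \<Theta> (fst z)) has_derivative (\<lambda>z. fst z * t)) (at (r, \<theta>, pr, p\<theta>))"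
    using assms by (auto intro: has_derivative_compose_fst)
  show ?thesis
    unfolding I1_def I2_def case_prod_beta
    using assms(1)
    by (auto intro!: derivative_eq_intros T ext simp: field_simps power2_eq_square)
qed

lemma has_derivative_I2:
  assumes "\<beta> \<noteq> 0" "(\<Theta> has_real_derivative t) (at r)"
  shows "(I2 \<beta> \<Theta> \<gamma> has_derivative
           (\<lambda>(a, b, c, d). - \<beta> * sin (\<beta> * \<theta>) * t * p\<theta>\<^sup>2 * a + \<beta> * I1 \<beta> \<Theta> \<gamma> (r, \<theta>, pr, p\<theta>) * b
              - cos (\<beta> * \<theta>) * p\<theta> * c
              - (cos (\<beta> * \<theta>) * pr + 2 * \<beta> * sin (\<beta> * \<theta>) * \<Theta> r * p\<theta>) * d))
         (at (r, \<theta>, pr, p\<theta>))"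
proof -
  have T: "((\<lambda>z. \<Theta> (fst z)) has_derivative (\<lambda>z. fst z * t)) (at (r, \<theta>, pr, p\<theta>))"
    using assms by (auto intro: has_derivative_compose_fst)
  show ?thesis
    unfolding I1_def I2_def case_prod_beta
    using assms(1)
    by (auto intro!: derivative_eq_intros T ext simp: field_simps power2_eq_square)
qed

subsection \<open>Density of the independence set\<close>

text \<open>Nonempty open sets of reals are uncountable, so a countable set has empty
  interior.\<close>

lemma closure_Compl_countable:
  fixes S :: "real set"
  assumes "countable S"
  shows "closure (- S) = UNIV"
proof -
  have "interior S = {}"
  proof (rule ccontr)
    assume "interior S \<noteq> {}"
    then obtain x where "x \<in> interior S" "x \<notin> S"
      using open_minus_countable[OF assms] open_interior by metis
    then show False
      using interior_subset by blast
  qed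
  then show ?thesis
    by (simp add: closure_complement)
qed

lemma countable_zeros_cos_mult:
  fixes \<beta> :: real
  assumes "\<beta> \<noteq> 0"
  shows "countable {x. cos (\<beta> * x) = 0}"
proof -
  have "{x. cos (\<beta> * x) = 0} \<subseteq> range (\<lambda>n::int. (n * pi + pi / 2) / \<beta>)"
    using assms by (auto simp: cos_zero_iff_int2 image_iff field_simps)
  then show ?thesis
    by (rule countable_subset) simp
qed

text \<open>Density in two stages: \<open>?V\<close>, a product of dense sets, is dense in phase
  space, and every point of \<open>?V\<close> is a limit of points of \<open>?U\<close> along its
  line in the direction of \<open>pr\<close>.\<close>

lemma phase_space_subset_closure_I2:
  assumes "\<beta> \<noteq> 0"
  shows "phase_space a b
    \<subseteq> closure {z \<in> phase_space a b. fst (snd (snd z)) \<noteq> 0 \<and> I2 \<beta> \<Theta> \<gamma> z \<noteq> 0}"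
    (is "_ \<subseteq> closure ?U")
proof -
  let ?V = "{a<..<b} \<times> (- {x. cos (\<beta> * x) = 0}) \<times> (UNIV :: real set) \<times> (- {0 :: real})"
  \<comment> \<open>For \<open>cos (\<beta>\<theta>) \<noteq> 0\<close> and \<open>p\<^sub>\<theta> \<noteq> 0\<close>, \<open>I\<^sub>2\<close> is a non-constant affine function of \<open>p\<^sub>r\<close>.\<close>
  have "?V \<subseteq> closure ?U"
  proof
    fix z assume "z \<in> ?V"
    obtain r \<theta> pr p\<theta> where z: "z = (r, \<theta>, pr, p\<theta>)"
      by (cases z)
    with \<open>z \<in> ?V\<close> have r: "r \<in> {a<..<b}" and nz: "cos (\<beta> * \<theta>) \<noteq> 0" "p\<theta> \<noteq> 0"
      by simp_all
    \<comment> \<open>The only value of \<open>pr\<close> at which \<open>I2\<close> vanishes, the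
      other coordinates being fixed.\<close>
    define m where "m = - (\<beta> * sin (\<beta> * \<theta>) * \<Theta> r * p\<theta>\<^sup>2 + \<gamma> / \<beta> * sin (\<beta> * \<theta>))
                          / (cos (\<beta> * \<theta>) * p\<theta>)"
    let ?h = "\<lambda>x. (r, \<theta>, x, p\<theta>)"
    have "?h x \<in> ?U" if "x \<noteq> 0" "x \<noteq> m" for x
    proof -
      have "I2 \<beta> \<Theta> \<gamma> (?h x) \<noteq> 0"
        using that nz unfolding I2_def m_def by (auto simp: field_simps)
      then show ?thesis
        using that r by (simp add: phase_space_def)
    qed
    then have "?h ` (- {0, m}) \<subseteq> closure ?U"
      using closure_subset by blast
    moreover have "continuous_on (closure (- {0, m})) ?h"
      by (intro continuous_intros)
    ultimately have "?h ` closure (- {0, m}) \<subseteq> closure ?U"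
      by (intro image_closure_subset) auto
    then show "z \<in> closure ?U"
      using closure_Compl_countable[of "{0, m}"] z by auto
  qed
  then have "closure ?V \<subseteq> closure ?U"
    by (simp add: closure_minimal)
  moreover have "phase_space a b \<subseteq> closure ?V"
    unfolding closure_Times phase_space_def
    using closure_subset closure_Compl_countable[OF countable_zeros_cos_mult[OF assms]]
      closure_Compl_countable[of "{0}"] by auto
  ultimately show ?thesis
    by blast
qed

section \<open>Constants of motion, their algebraic relation and superintegrability\<close>

theorem mainTheorem1:
  fixes rN rS K \<beta> \<gamma> :: real and f g \<Theta> :: "real \<Rightarrow> real"
  assumes surface: "spherical_surface_of_revolution rN rS f g"
    and curvature: "\<And>r. r \<in> {rN<..<rS} \<Longrightarrow> gaussian_curvature f r = K"
    and beta_nz: "\<beta> \<noteq> 0"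
    and beta: "\<And>r. r \<in> {rN<..<rS} \<Longrightarrow> - f r * deriv (deriv f) r + (deriv f r)\<^sup>2 = \<beta>\<^sup>2"
    and antideriv: "\<And>r. r \<in> {rN<..<rS} \<Longrightarrow> (\<Theta> has_real_derivative 1 / (f r)\<^sup>2) (at r)"
    and Theta: "\<And>r. r \<in> {rN<..<rS} \<Longrightarrow> deriv f r / f r = - \<beta>\<^sup>2 * \<Theta> r"
    and gamma: "\<gamma> > 0"
  defines "M \<equiv> phase_space rN rS"
    and "H \<equiv> Ham f \<Theta> \<gamma>"
    and "J1 \<equiv> I1 \<beta> \<Theta> \<gamma>"
    and "J2 \<equiv> I2 \<beta> \<Theta> \<gamma>"
  shows "constant_of_motion M H H \<and> constant_of_motion M H P\<theta> \<and>
         constant_of_motion M H J1 \<and> constant_of_motion M H J2 \<and>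
         (\<forall>z\<in>M. (J1 z)\<^sup>2 + (J2 z)\<^sup>2
            = 2 * (P\<theta> z)\<^sup>2 * H z - K * (P\<theta> z)^4 / \<beta>\<^sup>2 + \<gamma>\<^sup>2 / \<beta>\<^sup>2) \<and>
         (\<exists>A\<subseteq>{..<4::nat}. card A = 3 \<and>
            functionally_independent M A (\<lambda>i. [H, P\<theta>, J1, J2] ! i)) \<and>
         maximally_superintegrable M H"
proof -
  define \<kappa> where "\<kappa> = K / \<beta>\<^sup>2"
  have f_nz: "f r \<noteq> 0" if "r \<in> {rN<..<rS}" for r
    using surface that unfolding spherical_surface_of_revolution_def by auto
  \<comment> \<open>Away from the poles the derivative within the closed interval is two-sided, so
    \<open>deriv f r\<close> is a genuine derivative.\<close>
  have f_deriv: "(f has_real_derivative deriv f r) (at r)" if "r \<in> {rN<..<rS}" for r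
  proof -
    obtain D where "D 0 = f"
      and D: "\<forall>n. \<forall>r\<in>{rN..rS}. (D n has_real_derivative D (Suc n) r) (at r within {rN..rS})"
      using surface unfolding spherical_surface_of_revolution_def smooth_on_Icc_def by blast
    then have "(f has_real_derivative D 1 r) (at r within {rN..rS})"
      using that by (metis One_nat_def atLeastAtMost_iff greaterThanLessThan_iff less_imp_le)
    then have "(f has_real_derivative D 1 r) (at r)"
      using that by (simp add: at_within_Icc_at)
    then show ?thesis
      using DERIV_imp_deriv by metis
  qed
  have f': "deriv f r = - \<beta>\<^sup>2 * \<Theta> r * f r" if "r \<in> {rN<..<rS}" for r
    using Theta[OF that] f_nz[OF that] by (simp add: field_simps)
  have inv_f: "1 / (f r)\<^sup>2 = \<beta>\<^sup>2 * (\<Theta> r)\<^sup>2 + \<kappa>" if "r \<in> {rN<..<rS}" for r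
  proof -
    have "deriv (deriv f) r = - K * f r"
      using curvature[OF that] f_nz[OF that] unfolding gaussian_curvature_def
      by (simp add: field_simps)
    \<comment> \<open>This is \<open>f'^2 + K f^2 = \<beta>^2\<close> with
      \<open>f' = - \<beta>^2 \<Theta> f\<close> inserted; the factor \<beta>^2 is displayed on both
      sides to be cancelled next.\<close>
    then have "\<beta>\<^sup>2 * 1 = \<beta>\<^sup>2 * ((\<beta>\<^sup>2 * (\<Theta> r)\<^sup>2 + \<kappa>) * (f r)\<^sup>2)"
      using beta[OF that] f'[OF that] beta_nz unfolding \<kappa>_def
      by (simp add: field_simps power2_eq_square)
    then have "1 = (\<beta>\<^sup>2 * (\<Theta> r)\<^sup>2 + \<kappa>) * (f r)\<^sup>2"
      using beta_nz by simp
    then show ?thesis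
      using f_nz[OF that] by (simp add: field_simps)
  qed
  have riccati: "(\<Theta> has_real_derivative \<beta>\<^sup>2 * (\<Theta> r)\<^sup>2 + \<kappa>) (at r)" if "r \<in> {rN<..<rS}" for r
    using antideriv[OF that] inv_f[OF that] by simp
  note smooth = smooth_polynomial_in_phase_gens[of rN rS \<Theta> \<beta> \<kappa>, OF riccati, folded M_def]
  note poly = polynomial_in_intros polynomial_in_phase_gens
  have open_M: "open M"
    unfolding M_def by (rule open_phase_space)

  have smooth_H: "smooth_on_phase M H"
  proof (rule smooth_on_phase_cong[OF open_M])
    \<comment> \<open>Writing \<open>1 / f^2\<close> as a polynomial in \<Theta> brings
      \<open>H\<close> into the algebra.\<close>
    show "smooth_on_phase M (\<lambda>z. (fst (snd (snd z)))\<^sup>2 * (1 / 2)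
      + (snd (snd (snd z)))\<^sup>2 * (\<beta>\<^sup>2 * (\<Theta> (fst z))\<^sup>2 + \<kappa>) * (1 / 2) + \<gamma> * \<Theta> (fst z))"
      by (intro smooth poly)
    show "(fst (snd (snd z)))\<^sup>2 * (1 / 2)
      + (snd (snd (snd z)))\<^sup>2 * (\<beta>\<^sup>2 * (\<Theta> (fst z))\<^sup>2 + \<kappa>) * (1 / 2) + \<gamma> * \<Theta> (fst z) = H z"
      if "z \<in> M" for z
      using that inv_f[of "fst z", symmetric]
      by (auto simp: M_def phase_space_def H_def Ham_def)
  qed
  have smooth_P: "smooth_on_phase M P\<theta>"
    unfolding P\<theta>_def case_prod_beta by (intro smooth poly)
  have smooth_J1: "smooth_on_phase M J1"
    unfolding J1_def I1_def case_prod_beta by (intro smooth poly)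
  have smooth_J2: "smooth_on_phase M J2"
    unfolding J2_def I2_def case_prod_beta by (intro smooth poly)

  \<comment> \<open>Since \<open>f' / f = - \<beta>^2 \<Theta>\<close>, the
    \<open>r\<close>-derivative of \<open>H\<close> acquires the factor \<open>1 / f^2\<close>, the
    derivative of \<Theta>. All terms of the brackets of \<open>J1\<close> and \<open>J2\<close>
    with \<open>H\<close> then share this factor and cancel.\<close>
  have dH: "(H has_derivative (\<lambda>(a, b, c, d).
      (\<gamma> + \<beta>\<^sup>2 * \<Theta> r * p\<theta>\<^sup>2) / (f r)\<^sup>2 * a + pr * c + p\<theta> / (f r)\<^sup>2 * d)) (at (r, \<theta>, pr, p\<theta>))"
    if "r \<in> {rN<..<rS}" for r \<theta> pr p\<theta>
  proof -
    have "\<gamma> * (1 / (f r)\<^sup>2) - p\<theta>\<^sup>2 * deriv f r / (f r)^3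
        = (\<gamma> + \<beta>\<^sup>2 * \<Theta> r * p\<theta>\<^sup>2) / (f r)\<^sup>2"
      using f_nz[OF that] unfolding f'[OF that]
      by (simp add: field_simps power2_eq_square power3_eq_cube)
    then show ?thesis
      using has_derivative_Ham[OF f_nz f_deriv antideriv, OF that that that, of \<gamma> p\<theta> pr \<theta>]
      unfolding H_def by simp
  qed
  note dJ1 = has_derivative_I1[OF beta_nz antideriv, where \<gamma> = \<gamma>, folded J1_def J2_def]
  note dJ2 = has_derivative_I2[OF beta_nz antideriv, where \<gamma> = \<gamma>, folded J1_def J2_def]
  note differentials = differential_eq[OF dH] differential_eq[OF has_derivative_P\<theta>]
    differential_eq[OF dJ1] differential_eq[OF dJ2]

  have bracket: "poisson_bracket F H z = 0" if "z \<in> M" "F \<in> {H, P\<theta>, J1, J2}" for z F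
  proof -
    obtain r \<theta> pr p\<theta> where z: "z = (r, \<theta>, pr, p\<theta>)" and r: "r \<in> {rN<..<rS}"
      using \<open>z \<in> M\<close> by (auto simp: M_def phase_space_def)
    show ?thesis
      using that(2) r f_nz[OF r] beta_nz
      by (auto simp: z poisson_bracket_def differentials)
        (auto simp: J1_def J2_def I1_def I2_def field_simps power2_eq_square)
  qed
  have relation: "(J1 z)\<^sup>2 + (J2 z)\<^sup>2
      = 2 * (P\<theta> z)\<^sup>2 * H z - K * (P\<theta> z)^4 / \<beta>\<^sup>2 + \<gamma>\<^sup>2 / \<beta>\<^sup>2" if "z \<in> M" for z
  proof -
    obtain r \<theta> pr p\<theta> where z: "z = (r, \<theta>, pr, p\<theta>)" and r: "r \<in> {rN<..<rS}"
      using \<open>z \<in> M\<close> by (auto simp: M_def phase_space_def)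
    \<comment> \<open>The pair (\<open>J1\<close>, \<open>J2\<close>) is an orthogonal transform of
      (\<open>A\<close>, \<open>B\<close>), so the sum of squares is free of \<theta>.\<close>
    define A where "A = pr * p\<theta>"
    define B where "B = \<beta> * \<Theta> r * p\<theta>\<^sup>2 + \<gamma> / \<beta>"
    have "(J1 z)\<^sup>2 + (J2 z)\<^sup>2
        = (sin (\<beta> * \<theta>) * A - cos (\<beta> * \<theta>) * B)\<^sup>2 + (cos (\<beta> * \<theta>) * A + sin (\<beta> * \<theta>) * B)\<^sup>2"
      unfolding J1_def J2_def I1_def I2_def z A_def B_def prod.case by algebra
    also have "\<dots> = ((sin (\<beta> * \<theta>))\<^sup>2 + (cos (\<beta> * \<theta>))\<^sup>2) * (A\<^sup>2 + B\<^sup>2)"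
      by algebra
    also have "\<dots> = A\<^sup>2 + B\<^sup>2"
      by simp
    \<comment> \<open>The term \<open>\<kappa> * p\<theta>^4\<close> is added and subtracted to
      complete \<open>\<beta>^2 \<Theta>^2\<close> to \<open>1 / f^2\<close>, which makes the
      bracket equal to \<open>H\<close>.\<close>
    also have "\<dots> = 2 * p\<theta>\<^sup>2 * (pr\<^sup>2 / 2 + p\<theta>\<^sup>2 * (\<beta>\<^sup>2 * (\<Theta> r)\<^sup>2 + \<kappa>) / 2 + \<gamma> * \<Theta> r)
        - \<kappa> * p\<theta>^4 + \<gamma>\<^sup>2 / \<beta>\<^sup>2"
      using beta_nz unfolding A_def B_def by (simp add: field_simps power2_eq_square power4_eq_xxxx)
    also have "\<dots> = 2 * (P\<theta> z)\<^sup>2 * H z - K * (P\<theta> z)^4 / \<beta>\<^sup>2 + \<gamma>\<^sup>2 / \<beta>\<^sup>2"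
      unfolding inv_f[OF r, symmetric] by (simp add: z H_def Ham_def P\<theta>_def \<kappa>_def)
    finally show ?thesis .
  qed

  let ?F = "\<lambda>i. [H, P\<theta>, J1, J2] ! i"
  have three: "{..<3} = {0, 1, 2::nat}"
    by auto
  have indep: "functionally_independent M {..<3} ?F"
    unfolding functionally_independent_def
  proof (intro exI[of _ "{z \<in> M. fst (snd (snd z)) \<noteq> 0 \<and> J2 z \<noteq> 0}"] conjI ballI allI impI)
    let ?U = "{z \<in> M. fst (snd (snd z)) \<noteq> 0 \<and> J2 z \<noteq> 0}"
    \<comment> \<open>Openness: \<open>?U\<close> is the set in \<open>M\<close> where the
      continuous function \<open>pr * J2\<close> is nonzero.\<close>
    have "continuous_on M J2"
      using smooth_J2 unfolding smooth_on_phase_def by (metis Ck_on.simps(1))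
    then have "continuous_on M (\<lambda>z. fst (snd (snd z)) * J2 z)"
      by (intro continuous_intros)
    then have "open ((\<lambda>z. fst (snd (snd z)) * J2 z) -` (- {0}) \<inter> M)"
      using open_M continuous_on_open_vimage by blast
    moreover have "(\<lambda>z. fst (snd (snd z)) * J2 z) -` (- {0}) \<inter> M = ?U"
      by auto
    ultimately show "open ?U"
      by simp
    show "?U \<subseteq> M"
      by blast
    show "M \<subseteq> closure ?U"
      unfolding M_def J2_def by (rule phase_space_subset_closure_I2[OF beta_nz])
    fix z assume "z \<in> ?U"
    obtain r \<theta> pr p\<theta> where z: "z = (r, \<theta>, pr, p\<theta>)"
      by (cases z)
    with \<open>z \<in> ?U\<close> have r: "r \<in> {rN<..<rS}" and nz: "pr \<noteq> 0" "J2 (r, \<theta>, pr, p\<theta>) \<noteq> 0"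
      by (simp_all add: M_def phase_space_def)
    show "?F i differentiable (at z)" if "i \<in> {..<3}" for i
    proof -
      have "H differentiable (at z)" "P\<theta> differentiable (at z)" "J1 differentiable (at z)"
        unfolding z by (rule differentiableI, rule dH[OF r] has_derivative_P\<theta> dJ1[OF r])+
      then show ?thesis
        using that unfolding three by auto
    qed
    fix c :: "nat \<Rightarrow> real" and i :: nat
    assume i: "i \<in> {..<3}" and sum: "\<forall>v. (\<Sum>i\<in>{..<3}. c i * differential (?F i) z v) = 0"
    have dep: "c 0 * differential H z v + c 1 * differential P\<theta> z v
        + c 2 * differential J1 z v = 0" for v
      using spec[OF sum, of v] by (simp add: three)
    \<comment> \<open>The system is triangular: the \<theta> direction sees only \<open>J1\<close>,
      with coefficient \<open>- \<beta> * J2\<close>; then the \<open>pr\<close> direction sees only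
      \<open>H\<close>, with coefficient \<open>pr\<close>; the \<open>p\<theta>\<close> direction
      is left for \<open>P\<theta>\<close>.\<close>
    have "c 2 = 0"
      using dep[of "(0, 1, 0, 0)"] nz beta_nz r by (simp add: z differentials)
    moreover from this have "c 0 = 0"
      using dep[of "(0, 0, 1, 0)"] nz r by (simp add: z differentials)
    moreover from calculation have "c 1 = 0"
      using dep[of "(0, 0, 0, 1)"] r by (simp add: z differentials)
    ultimately show "c i = 0"
      using i unfolding three by auto
  qed

  have com: "constant_of_motion M H H" "constant_of_motion M H P\<theta>"
      "constant_of_motion M H J1" "constant_of_motion M H J2"
    using smooth_H smooth_P smooth_J1 smooth_J2 bracket by (auto simp: constant_of_motion_def)
  moreover have "i \<in> {0, 1, 2}" if "i < 3" for i :: nat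
    using that by auto
  ultimately have "constant_of_motion M H (?F i)" if "i < 3" for i
    using that by fastforce
  then have "maximally_superintegrable M H"
    using indep unfolding maximally_superintegrable_def by blast
  moreover have "\<exists>A\<subseteq>{..<4::nat}. card A = 3 \<and> functionally_independent M A ?F"
    using indep by (intro exI[of _ "{..<3}"]) auto
  ultimately show ?thesis
    using com relation by blast
qed

end
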